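(* Let $\ell,N<\infty$ be positive integers and let $\ell_{GP}\in\mathbb{N}\cup\{\infty\}$ with $\ell\le \ell_{GP}$. Let $K(x,x')=\sum_{i=1}^{\ell_{GP}}\lambda_i\phi_i(x)\phi_i(x')$ be a Mercer kernel on $(\mathcal{X},\mu)$, and let $\mathcal{Q}_\ell=\{(x_k,w_k):k=1,\dots,N\}$ be a quadrature rule that orthogonalizes the functions $\psi_1,\dots,\psi_\ell$, where $\psi_i=\phi_i$ for $i=1,\dots,\ell$. Let $f:\mathcal{X}\to\mathbb{R}$ and $\bm{y}=[f(x_1),\dots,f(x_N)]^T$. Let $\hat f_\ell$ be the pseudospectral approximation of $f$ with basis $\{\psi_1,\dots,\psi_\ell\}$ computed with $\mathcal{Q}_\ell$, and let $m$ be the posterior mean of Gaussian process regression with zero prior mean, prior covariance kernel $K$ and nugget $\sigma^2>0$, constructed from the function evaluations $\bm{y}$ at the nodes of $\mathcal{Q}_\ell$. Let $$M=\max_{(x,w)\in\mathcal{Q}_\ell,\ i\in\{1,\dots,\ell\}}|\psi_i(x)|,\qquad w_{\max}=\max_{i\in\{1,\dots,N\}}|w_i|,$$ and let $s_N$ be the smallest eigenvalue of the matrix $[K(x_i,x_j)]_{i,j=1}^N$. Then $$\Vert m-\hat f_\ell\Vert_{L^2_\mu}^2\le \Vert\bm{y}\Vert_2^2\left(\frac{\ell N M^2 w_{\max}^2}{(s_N+\sigma^2)^2}\left\Vert\sum_{j=\ell+1}^{\ell_{GP}}\lambda_j\bm{\phi}_j\bm{\phi}_j^T+\sigma^2\m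athbf{I}\right\Vert_2^2+\sum_{j=\ell+1}^{\ell_{GP}}\lambda_j^2\,\bm{\phi}_j^T\mathbf{R}^2\bm{\phi}_j\right).$$
   Context: Mercer kernel: $\mathcal{X}\subseteq\mathbb{R}^d$ is first countable and endowed with a strictly positive Borel measure $\mu$; $K:\mathcal{X}\times\mathcal{X}\to\mathbb{R}$ is continuous, symmetric, positive semidefinite in the sense that $\int_{\mathcal{X}\times\mathcal{X}} K(x,x')g(x)g(x')\,d\mu(x)d\mu(x')\ge 0$ for all $g\in L^2_\mu(\mathcal{X})$, and $\int_{\mathcal{X}}|K(x,x)|\,d\mu(x)<\infty$. The $\lambda_i\ge0$ are the eigenvalues and the $\phi_i$ the eigenfunctions (orthonormal in $L^2_\mu(\mathcal{X})$, real-valued, defined pointwise) of the integral operator $T_Kg=\int_{\mathcal{X}} K(x,x')g(x')\,d\mu(x')$, and $K(x,x')=\sum_{i=1}^{\ell_{GP}}\lambda_i\phi_i(x)\phi_i(x')$ with absolute convergence for every pair $(x,x')$ (Mercer expansion); $\ell_{GP}$ is finite or infinite. Empty sums are zero. Orthogonalizing rule: nodes $x_k\in\mathcal{X}$ and weights $w_k\in\mathbb{R}$, $k=1,\dots,N$, orthogonalize $\psi_1,\dots,\psi_\ell$ if $\sum_{k=1}^N w_k\psi_i(x_k)\psi_j(x_k)=\int\psi_i\psi_j\,d\mu=\delta_{ij}$ for all $i,j=1,\dots,\ell$. Pseudospectral approximation: $\hat f_\ell(x)=\sum_{i=1}^\ell\left(\sum_{k=1}^N w_kf(x_k)\psi_i(x_k)\right)\psi_i(x)$.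 Notation: $\bm{\phi}_j=[\phi_j(x_1),\dots,\phi_j(x_N)]^T\in\mathbb{R}^N$; $\mathbf{R}$ is the inverse of the $N\times N$ matrix with entries $K(x_i,x_j)+\delta_{ij}\sigma^2$; $\mathbf{I}$ is the $N\times N$ identity; $\Vert\cdot\Vert_2$ is the Euclidean norm for vectors and the induced operator norm for matrices. Gaussian process posterior mean (zero prior mean): $m(x)=\bm{y}^T\mathbf{R}\,K(\bm{x},x)$, where $K(\bm{x},x)=[K(x_1,x),\dots,K(x_N,x)]^T$. *)

theory Defs
  imports "HOL-Analysis.Analysis"
begin

section \<open>The space \<open>L\<^sup>2\<^sub>\<mu>\<close>\<close>

definition square_integrable :: "'a measure \<Rightarrow> ('a \<Rightarrow> real) \<Rightarrow> bool" where
  "square_integrable \<mu> g \<longleftrightarrow> g \<in> borel_measurable \<mu> \<and> integrable \<mu> (\<lambda>x. (g x)\<^sup>2)"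

text \<open>Meaningful only for square-integrable \<open>g\<close>: the integral of a non-integrable function is
  \<open>0\<close>.\<close>

definition L2_norm :: "'a measure \<Rightarrow> ('a \<Rightarrow> real) \<Rightarrow> real" where
  "L2_norm \<mu> g = sqrt (\<integral>x. (g x)\<^sup>2 \<partial>\<mu>)"

section \<open>Mercer kernels\<close>

text \<open>Functions on \<open>X\<close> are total functions of which only the values on \<open>X\<close> matter. The set \<open>X\<close>
  carries the subspace topology, which is first countable for every subset of \<open>real ^ 'd\<close>.\<close>

definition strictly_positive_borel :: "(real ^ 'd) set \<Rightarrow> (real ^ 'd) measure \<Rightarrow> bool" where
  "strictly_positive_borel X \<mu> \<longleftrightarrow>
     sets \<mu> = sets (restrict_space borel X) \<and>
     (\<forall>U. openin (top_of_set X) U \<longrightarrow> U \<noteq> {} \<longrightarrow> emeasure \<mu> U > 0)"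

definition mercer_kernel ::
  "(real ^ 'd) set \<Rightarrow> (real ^ 'd) measure \<Rightarrow> (real ^ 'd \<Rightarrow> real ^ 'd \<Rightarrow> real) \<Rightarrow> bool" where
  "mercer_kernel X \<mu> K \<longleftrightarrow>
     strictly_positive_borel X \<mu> \<and>
     continuous_on (X \<times> X) (\<lambda>(x, x'). K x x') \<and>
     (\<forall>x\<in>X. \<forall>x'\<in>X. K x x' = K x' x) \<and>
     (\<forall>g. square_integrable \<mu> g \<longrightarrow>
        (\<integral>(x, x'). K x x' * g x * g x' \<partial>(\<mu> \<Otimes>\<^sub>M \<mu>)) \<ge> 0) \<and>
     integrable \<mu> (\<lambda>x. \<bar>K x x\<bar>)"

definition kernel_operator ::
  "'a measure \<Rightarrow> ('a \<Rightarrow> 'a \<Rightarrow> real) \<Rightarrow> ('a \<Rightarrow> real) \<Rightarrow> 'a \<Rightarrow> real" where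
  "kernel_operator \<mu> K g x = (\<integral>x'. K x x' * g x' \<partial>\<mu>)"

definition index_upto :: "enat \<Rightarrow> nat set" where
  "index_upto L = {i. 1 \<le> i \<and> enat i \<le> L}"

text \<open>The eigenvalue equation is an identity in \<open>L\<^sup>2\<^sub>\<mu>\<close>, hence holds almost everywhere; the
  expansion of the kernel holds at every pair of points of \<open>X\<close>.\<close>

definition mercer_expansion ::
  "(real ^ 'd) set \<Rightarrow> (real ^ 'd) measure \<Rightarrow> (real ^ 'd \<Rightarrow> real ^ 'd \<Rightarrow> real) \<Rightarrow>
   enat \<Rightarrow> (nat \<Rightarrow> real) \<Rightarrow> (nat \<Rightarrow> real ^ 'd \<Rightarrow> real) \<Rightarrow> bool" where
  "mercer_expansion X \<mu> K L lam \<phi> \<longleftrightarrow>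
     (\<forall>i\<in>index_upto L. lam i \<ge> 0 \<and> square_integrable \<mu> (\<phi> i) \<and>
        (AE x in \<mu>. kernel_operator \<mu> K (\<phi> i) x = lam i * \<phi> i x)) \<and>
     (\<forall>i\<in>index_upto L. \<forall>j\<in>index_upto L.
        (\<integral>x. \<phi> i x * \<phi> j x \<partial>\<mu>) = (if i = j then 1 else 0)) \<and>
     (\<forall>x\<in>X. \<forall>x'\<in>X.
        (\<lambda>i. \<bar>lam i * \<phi> i x * \<phi> i x'\<bar>) summable_on index_upto L \<and>
        K x x' = (\<Sum>\<^sub>\<infinity>i\<in>index_upto L. lam i * \<phi> i x * \<phi> i x'))"

section \<open>Quadrature and pseudospectral approximation\<close>

text \<open>A rule with \<open>N\<close> nodes is a pair of families, of nodes \<open>xs\<close> and of weights \<open>w\<close>, indexed by a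
  finite type \<open>'n\<close> with \<open>CARD('n) = N\<close>. Nodes may repeat.\<close>

definition orthogonalizes ::
  "'a measure \<Rightarrow> ('n::finite \<Rightarrow> 'a) \<Rightarrow> ('n \<Rightarrow> real) \<Rightarrow> nat \<Rightarrow> (nat \<Rightarrow> 'a \<Rightarrow> real) \<Rightarrow> bool" where
  "orthogonalizes \<mu> xs w l \<psi> \<longleftrightarrow>
     (\<forall>i\<in>{1..l}. \<forall>j\<in>{1..l}.
        (\<Sum>k\<in>UNIV. w k * \<psi> i (xs k) * \<psi> j (xs k)) = (\<integral>x. \<psi> i x * \<psi> j x \<partial>\<mu>) \<and>
        (\<integral>x. \<psi> i x * \<psi> j x \<partial>\<mu>) = (if i = j then 1 else 0))"

definition pseudospectral ::
  "('n::finite \<Rightarrow> 'a) \<Rightarrow> ('n \<Rightarrow> real) \<Rightarrow> nat \<Rightarrow> (nat \<Rightarrow> 'a \<Rightarrow> real) \<Rightarrow> ('a \<Rightarrow> real) \<Rightarrow> 'a \<Rightarrow> real" where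
  "pseudospectral xs w l \<psi> f x =
     (\<Sum>i=1..l. (\<Sum>k\<in>UNIV. w k * f (xs k) * \<psi> i (xs k)) * \<psi> i x)"

section \<open>Gaussian process regression\<close>

definition node_vec :: "('n::finite \<Rightarrow> 'a) \<Rightarrow> ('a \<Rightarrow> real) \<Rightarrow> real ^ 'n" where
  "node_vec xs g = (\<chi> k. g (xs k))"

definition kernel_matrix :: "('a \<Rightarrow> 'a \<Rightarrow> real) \<Rightarrow> ('n::finite \<Rightarrow> 'a) \<Rightarrow> real ^ 'n ^ 'n" where
  "kernel_matrix K xs = (\<chi> i j. K (xs i) (xs j))"

definition gp_R :: "('a \<Rightarrow> 'a \<Rightarrow> real) \<Rightarrow> real \<Rightarrow> ('n::finite \<Rightarrow> 'a) \<Rightarrow> real ^ 'n ^ 'n" where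
  "gp_R K \<sigma> xs = matrix_inv (\<chi> i j. K (xs i) (xs j) + (if i = j then \<sigma>\<^sup>2 else 0))"

definition gp_posterior_mean ::
  "('a \<Rightarrow> 'a \<Rightarrow> real) \<Rightarrow> real \<Rightarrow> ('n::finite \<Rightarrow> 'a) \<Rightarrow> real ^ 'n \<Rightarrow> 'a \<Rightarrow> real" where
  "gp_posterior_mean K \<sigma> xs y x = y \<bullet> (gp_R K \<sigma> xs *v node_vec xs (\<lambda>x'. K x' x))"

definition eigenvalues :: "real ^ 'n ^ 'n \<Rightarrow> real set" where
  "eigenvalues A = {c. \<exists>v. v \<noteq> 0 \<and> A *v v = c *\<^sub>R v}"

text \<open>The operator norm induced by the Euclidean norm.\<close>

abbreviation matrix_norm2 :: "real ^ 'n ^ 'm \<Rightarrow> real" where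
  "matrix_norm2 A \<equiv> onorm ((*v) A)"

end

theory Submission
  imports Defs
begin

text \<open>On \<open>X\<close> the difference \<open>m - fhat\<close> is the orthonormal series with coefficients
  \<open>lam j * (y \<bullet> R \<phi>\<^sub>j)\<close> for \<open>j > l\<close> and \<open>y \<bullet> (lam i R \<phi>\<^sub>i - W \<phi>\<^sub>i)\<close> for \<open>i \<le> l\<close>, where
  \<open>W\<close> is the diagonal matrix of the weights, so its squared norm is at most the sum of the squares
  of these coefficients. Discrete orthonormality turns
  \<open>lam i R \<phi>\<^sub>i - W \<phi>\<^sub>i\<close> into \<open>- R (E + \<sigma>\<^sup>2 I) W \<phi>\<^sub>i\<close>, where \<open>E\<close> is the tail of the
  kernel matrix; the norm of \<open>R\<close> is at most \<open>1 / (s\<^sub>N + \<sigma>\<^sup>2)\<close>.\<close>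

section \<open>Symmetric matrices\<close>

lemma inner_symmetric_matrix:
  fixes A :: "real ^ 'n ^ 'n"
  assumes "transpose A = A"
  shows "u \<bullet> (A *v v) = (A *v u) \<bullet> v"
  by (metis assms dot_lmul_matrix vector_transpose_matrix)

text \<open>Eigenvectors belonging to distinct eigenvalues are orthogonal, and finite dimension
  leaves room for only finitely many of them. Finiteness makes \<open>Min (eigenvalues A)\<close>
  the genuine smallest eigenvalue.\<close>

lemma finite_eigenvalues_symmetric:
  fixes A :: "real ^ 'n ^ 'n"
  assumes "transpose A = A"
  shows "finite (eigenvalues A)"
proof -
  define v where "v c = (SOME v. v \<noteq> 0 \<and> A *v v = c *\<^sub>R v)" for c
  have v: "v c \<noteq> 0 \<and> A *v v c = c *\<^sub>R v c" if "c \<in> eigenvalues A" for c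
    unfolding v_def by (rule someI_ex) (use that in \<open>simp add: eigenvalues_def\<close>)
  have orth: "v c \<bullet> v d = 0" if "c \<in> eigenvalues A" "d \<in> eigenvalues A" "c \<noteq> d" for c d
  proof -
    have "v c \<bullet> (A *v v d) = (A *v v c) \<bullet> v d"
      by (rule inner_symmetric_matrix[OF assms])
    then show ?thesis
      using v[OF that(1)] v[OF that(2)] that(3) by simp
  qed
  have "inj_on v (eigenvalues A)"
    by (rule inj_onI) (metis orth v inner_eq_zero_iff)
  moreover have "finite (v ` eigenvalues A)"
    by (rule pairwise_orthogonal_imp_finite) (auto simp: pairwise_def orthogonal_def intro: orth)
  ultimately show ?thesis
    by (rule finite_imageD[rotated])
qed

text \<open>A minimizer of the Rayleigh quotient on the unit sphere is an eigenvector.\<close>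

lemma rayleigh_minimum_eigenvalue:
  fixes A :: "real ^ 'n ^ 'n"
  assumes sym: "transpose A = A"
  obtains s where "s \<in> eigenvalues A" "\<And>v. s * (norm v)\<^sup>2 \<le> v \<bullet> (A *v v)"
proof -
  let ?S = "sphere (0 :: real ^ 'n) 1"
  have "?S \<noteq> {}"
    by simp
  moreover have "continuous_on ?S (\<lambda>v. v \<bullet> (A *v v))"
    by (intro continuous_intros linear_continuous_on matrix_vector_mul_bounded_linear)
  ultimately obtain z where z: "z \<in> ?S" and min: "\<And>v. v \<in> ?S \<Longrightarrow> z \<bullet> (A *v z) \<le> v \<bullet> (A *v v)"
    using continuous_attains_inf[OF compact_sphere] by blast
  define s where "s = z \<bullet> (A *v z)"
  have nz: "norm z = 1"
    using z by simp
  have bound: "s * (norm v)\<^sup>2 \<le> v \<bullet> (A *v v)" for v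
  proof (cases "v = 0")
    case False
    have "s \<le> (v /\<^sub>R norm v) \<bullet> (A *v (v /\<^sub>R norm v))"
      unfolding s_def by (rule min) (use False in simp)
    also have "\<dots> = (v \<bullet> (A *v v)) / (norm v)\<^sup>2"
      by (simp add: matrix_vector_mult_scaleR power2_eq_square divide_inverse)
    finally show ?thesis
      using False by (simp add: field_simps)
  qed simp
  define r where "r = A *v z - s *\<^sub>R z"
  \<comment> \<open>Test \<open>bound\<close> at z + t r. The constant terms cancel because
    \<open>s\<close> is the value at the unit vector \<open>z\<close>, and the linear term is 2 t (r
    . (A z - s z)) = 2 t |r|^2.\<close>
  have perturb: "0 \<le> 2 * t * (norm r)\<^sup>2 + t\<^sup>2 * (r \<bullet> (A *v r) - s * (norm r)\<^sup>2)" for t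
  proof -
    have "z \<bullet> (A *v r) = (A *v z) \<bullet> r"
      by (rule inner_symmetric_matrix[OF sym])
    then show ?thesis
      using bound[of "z + t *\<^sub>R r"] nz
      unfolding power2_norm_eq_inner norm_eq_1
      by (simp add: r_def s_def matrix_vector_right_distrib matrix_vector_mult_scaleR inner_add_left
          inner_add_right inner_diff_left inner_diff_right inner_commute algebra_simps power2_eq_square)
  qed
  have "r = 0"
  proof (rule ccontr)
    assume "r \<noteq> 0"
    define a where "a = (norm r)\<^sup>2"
    define b where "b = r \<bullet> (A *v r) - s * (norm r)\<^sup>2"
    have a: "a > 0"
      using \<open>r \<noteq> 0\<close> by (simp add: a_def)
    have b: "b \<ge> 0"
      using bound[of r] by (simp add: b_def)
    \<comment> \<open>For small negative t the linear term outweighs the quadratic one; this t is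
      such a choice, and the 1 in the denominator allows for b = 0.\<close>
    have "0 \<le> 2 * (- a / (b + 1)) * a + (- a / (b + 1))\<^sup>2 * b"
      using perturb[of "- a / (b + 1)"] by (simp add: a_def b_def)
    also have "\<dots> = - (a\<^sup>2 * (b + 2) / (b + 1)\<^sup>2)"
      using b by (simp add: divide_simps) (simp add: power2_eq_square algebra_simps)
    also have "\<dots> < 0"
      using a b by simp
    finally show False
      by simp
  qed
  then have "s \<in> eigenvalues A"
    using nz unfolding eigenvalues_def r_def by (auto intro!: exI[of _ z])
  then show thesis
    using bound that by blast
qed

text \<open>The Rayleigh minimum is itself an eigenvalue, so the set is nonempty and its
  \<open>Min\<close> lies at or below that minimum.\<close>

lemma Min_eigenvalues_symmetric:
  fixes A :: "real ^ 'n ^ 'n"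
  assumes "transpose A = A"
  shows "Min (eigenvalues A) \<in> eigenvalues A"
    and "Min (eigenvalues A) * (norm v)\<^sup>2 \<le> v \<bullet> (A *v v)"
proof -
  obtain s where s: "s \<in> eigenvalues A" "\<And>v. s * (norm v)\<^sup>2 \<le> v \<bullet> (A *v v)"
    using rayleigh_minimum_eigenvalue[OF assms] by blast
  note fin = finite_eigenvalues_symmetric[OF assms]
  show "Min (eigenvalues A) \<in> eigenvalues A"
    using fin s(1) by (intro Min_in) auto
  have "Min (eigenvalues A) * (norm v)\<^sup>2 \<le> s * (norm v)\<^sup>2"
    using fin s(1) by (intro mult_right_mono) auto
  with s(2)[of v] show "Min (eigenvalues A) * (norm v)\<^sup>2 \<le> v \<bullet> (A *v v)"
    by simp
qed

section \<open>Inverses of coercive matrices\<close>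

lemma matrix_inv_mult:
  fixes B :: "real ^ 'n ^ 'n"
  assumes "invertible B"
  shows matrix_inv_right: "B ** matrix_inv B = mat 1"
    and matrix_inv_left: "matrix_inv B ** B = mat 1"
proof -
  have "B ** matrix_inv B = mat 1 \<and> matrix_inv B ** B = mat 1"
    unfolding matrix_inv_def by (rule someI_ex) (use assms in \<open>simp add: invertible_def\<close>)
  then show "B ** matrix_inv B = mat 1" "matrix_inv B ** B = mat 1"
    by simp_all
qed

text \<open>Cauchy-Schwarz turns coercivity into c |v| <= |B v|. This makes the kernel trivial, and
  at v = B^-1 u it is the norm bound for the inverse.\<close>

lemma matrix_inv_coercive:
  fixes B :: "real ^ 'n ^ 'n"
  assumes "c > 0" and coercive: "\<And>v. c * (norm v)\<^sup>2 \<le> v \<bullet> (B *v v)"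
  shows "invertible B" and "norm (matrix_inv B *v u) \<le> norm u / c"
proof -
  have low: "c * norm v \<le> norm (B *v v)" for v
  proof (cases "v = 0")
    case False
    have "c * norm v * norm v \<le> norm (B *v v) * norm v"
      using coercive[of v] norm_cauchy_schwarz[of v "B *v v"]
      by (simp add: power2_eq_square mult.commute mult.left_commute)
    then show ?thesis
      using False by simp
  qed simp
  have "v = 0" if "B *v v = 0" for v
    using low[of v] that \<open>c > 0\<close> by (simp add: mult_le_0_iff)
  then show inv: "invertible B"
    by (metis invertible_left_inverse matrix_left_invertible_ker)
  then have "B *v (matrix_inv B *v u) = u"
    by (simp add: matrix_inv_right matrix_vector_mul_assoc)
  then show "norm (matrix_inv B *v u) \<le> norm u / c"
    using low[of "matrix_inv B *v u"] \<open>c > 0\<close> by (simp add: field_simps)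
qed

lemma transpose_matrix_inv_symmetric:
  fixes B :: "real ^ 'n ^ 'n"
  assumes "invertible B" "transpose B = B"
  shows "transpose (matrix_inv B) = matrix_inv B"
proof -
  have "transpose (matrix_inv B) ** B = mat 1"
    by (metis assms matrix_inv_right matrix_transpose_mul transpose_mat)
  then have "transpose (matrix_inv B) ** (B ** matrix_inv B) = matrix_inv B"
    by (simp add: matrix_mul_assoc)
  then show ?thesis
    by (simp add: matrix_inv_right[OF assms(1)])
qed

section \<open>Outer products and shifts by a multiple of the identity\<close>

lemma matrix_scaleR_mat_1_mult:
  fixes A :: "real ^ 'n ^ 'n"
  shows "(A + t *\<^sub>R mat 1) *v v = A *v v + t *\<^sub>R v"
  by (simp add: matrix_vector_mult_add_rdistrib flip: scaleR_matrix_vector_assoc)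

text \<open>The matrix p p^T, given by its entries so that no inner dimension of a matrix product
  has to be fixed.\<close>

definition outer_product :: "real ^ 'n \<Rightarrow> real ^ 'n ^ 'n" where
  "outer_product p = (\<chi> a b. p $ a * p $ b)"

lemma outer_product_mult: "outer_product p *v v = (p \<bullet> v) *\<^sub>R p"
  by (simp add: outer_product_def vec_eq_iff matrix_vector_mult_def inner_vec_def sum_distrib_left
      sum_distrib_right mult.assoc mult.commute mult.left_commute)

text \<open>The inner dimension \<open>'k\<close> of the product of a column by a row is not determined by the
  vector, and the product carries the factor \<open>CARD('k)\<close>.\<close>

lemma columnvector_rowvector:
  fixes p :: "real ^ 'n"
  shows "(columnvector p :: real ^ 'k ^ 'n) ** rowvector p = real CARD('k) *\<^sub>R outer_product p"
  by (simp add: vec_eq_iff matrix_matrix_mult_def columnvector_def rowvector_def outer_product_def)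

text \<open>Enlarging the positive semidefinite part of \<open>E + t I\<close> can only enlarge its norm, which
  disposes of the factor \<open>CARD('k)\<close>.\<close>

lemma norm_psd_plus_scaled_le:
  fixes E :: "real ^ 'n ^ 'n"
  assumes psd: "0 \<le> q \<bullet> (E *v q)" and "1 \<le> c" "0 \<le> t"
  shows "norm (E *v q + t *\<^sub>R q) \<le> onorm ((*v) (c *\<^sub>R E + t *\<^sub>R mat 1)) * norm q"
proof -
  have "(norm (E *v q + t *\<^sub>R q))\<^sup>2
      = (norm (E *v q))\<^sup>2 + 2 * t * (q \<bullet> (E *v q)) + t\<^sup>2 * (norm q)\<^sup>2"
    unfolding power2_norm_eq_inner
    by (simp add: inner_add_left inner_add_right inner_commute power2_eq_square algebra_simps)
  \<comment> \<open>The cross term also grows with c, since it is nonnegative: \<open>E\<close> is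
    nonnegative at \<open>q\<close> and t >= 0.\<close>
  also have "\<dots> \<le> c\<^sup>2 * (norm (E *v q))\<^sup>2 + c * (2 * t * (q \<bullet> (E *v q))) + t\<^sup>2 * (norm q)\<^sup>2"
  proof (intro add_mono order_refl)
    show "(norm (E *v q))\<^sup>2 \<le> c\<^sup>2 * (norm (E *v q))\<^sup>2"
      using mult_right_mono[OF one_le_power[OF \<open>1 \<le> c\<close>], of "(norm (E *v q))\<^sup>2" 2] by simp
    show "2 * t * (q \<bullet> (E *v q)) \<le> c * (2 * t * (q \<bullet> (E *v q)))"
      using mult_right_mono[OF \<open>1 \<le> c\<close>, of "2 * t * (q \<bullet> (E *v q))"] assms by simp
  qed
  also have "\<dots> = (norm (c *\<^sub>R (E *v q) + t *\<^sub>R q))\<^sup>2"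
    unfolding power2_norm_eq_inner
    by (simp add: inner_add_left inner_add_right inner_commute power2_eq_square algebra_simps)
  finally have "norm (E *v q + t *\<^sub>R q) \<le> norm (c *\<^sub>R (E *v q) + t *\<^sub>R q)"
    by (rule power2_le_imp_le) simp
  also have "\<dots> = norm ((c *\<^sub>R E + t *\<^sub>R mat 1) *v q)"
    by (simp add: matrix_scaleR_mat_1_mult scaleR_matrix_vector_assoc)
  also have "\<dots> \<le> onorm ((*v) (c *\<^sub>R E + t *\<^sub>R mat 1)) * norm q"
    by (rule onorm) simp
  finally show ?thesis .
qed

text \<open>With \<open>B = A + t I\<close>, discrete orthonormality gives \<open>B q = lam i p\<^sub>i + (E + t I) q\<close>.\<close>

lemma regularized_coefficient_bound:
  fixes A E :: "real ^ 'n ^ 'n" and p :: "nat \<Rightarrow> real ^ 'n"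
  assumes low: "\<And>v. s * (norm v)\<^sup>2 \<le> v \<bullet> (A *v v)" and st: "0 < s + t"
    and A: "A = (\<Sum>j\<in>J. lam j *\<^sub>R outer_product (p j)) + E"
    and J: "finite J" "i \<in> J"
    and q: "\<And>j. j \<in> J \<Longrightarrow> p j \<bullet> q = (if j = i then 1 else 0)"
  shows "norm (lam i *\<^sub>R (matrix_inv (A + t *\<^sub>R mat 1) *v p i) - q)
    \<le> norm (E *v q + t *\<^sub>R q) / (s + t)"
proof -
  let ?B = "A + t *\<^sub>R mat 1"
  have coercive: "(s + t) * (norm v)\<^sup>2 \<le> v \<bullet> (?B *v v)" for v
    using low[of v]
    by (simp add: matrix_scaleR_mat_1_mult inner_add_right power2_norm_eq_inner distrib_right)
  note inv = matrix_inv_coercive[OF st coercive]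
  have "(\<Sum>j\<in>J. lam j *\<^sub>R outer_product (p j)) *v q = (\<Sum>j\<in>J. lam j *\<^sub>R ((p j \<bullet> q) *\<^sub>R p j))"
    using J(1) by (induction J rule: finite_induct)
      (simp_all add: matrix_vector_mult_add_rdistrib scaleR_matrix_vector_assoc[symmetric]
        outer_product_mult)
  also have "\<dots> = (\<Sum>j\<in>J. if j = i then lam i *\<^sub>R p i else 0)"
    by (rule sum.cong) (simp_all add: q)
  also have "\<dots> = lam i *\<^sub>R p i"
    using J by simp
  finally have "?B *v q = lam i *\<^sub>R p i + (E *v q + t *\<^sub>R q)"
    unfolding matrix_scaleR_mat_1_mult by (simp add: A matrix_vector_mult_add_rdistrib)
  moreover have "matrix_inv ?B *v (?B *v q) = q"
    by (simp add: matrix_vector_mul_assoc matrix_inv_left[OF inv(1)])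
  \<comment> \<open>Applying the inverse to B q leaves an error that is itself an image under the
    inverse, so coercivity alone controls it.\<close>
  ultimately have "q = lam i *\<^sub>R (matrix_inv ?B *v p i) + matrix_inv ?B *v (E *v q + t *\<^sub>R q)"
    by (metis matrix_vector_right_distrib matrix_vector_mult_scaleR)
  then have "norm (lam i *\<^sub>R (matrix_inv ?B *v p i) - q)
      = norm (matrix_inv ?B *v (E *v q + t *\<^sub>R q))"
    by (metis add_diff_cancel_left' norm_minus_commute)
  then show ?thesis
    using inv(2) by simp
qed

section \<open>Orthonormal series\<close>

text \<open>Unordered sums are limits along the finite subsets, and limits of vectors are taken
  componentwise. Applied twice, this reduces a series of matrices to its entries.\<close>

lemma has_sum_vecI:
  fixes f :: "'i \<Rightarrow> 'a :: {real_normed_vector} ^ 'n"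
  assumes "\<And>k. ((\<lambda>i. f i $ k) has_sum s $ k) I"
  shows "(f has_sum s) I"
  using assms unfolding has_sum_def by (auto intro!: vec_tendstoI)

text \<open>The bound |a b| <= a^2 + b^2 supplies the dominating function. Inner products are
  thereby true integrals and not the default value 0.\<close>

lemma integrable_mult_square_integrable:
  assumes "square_integrable \<mu> g" "square_integrable \<mu> h"
  shows "integrable \<mu> (\<lambda>x. g x * h x)"
proof (rule Bochner_Integration.integrable_bound)
  show "integrable \<mu> (\<lambda>x. (g x)\<^sup>2 + (h x)\<^sup>2)"
    using assms by (simp add: square_integrable_def)
  show "(\<lambda>x. g x * h x) \<in> borel_measurable \<mu>"
    using assms by (auto simp: square_integrable_def intro: borel_measurable_times)
  have "\<bar>a * b\<bar> \<le> a\<^sup>2 + b\<^sup>2" for a b :: real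
    using sum_squares_bound[of "\<bar>a\<bar>" "\<bar>b\<bar>"] abs_ge_zero[of "a * b"]
    unfolding abs_mult power2_abs by linarith
  then show "AE x in \<mu>. norm (g x * h x) \<le> norm ((g x)\<^sup>2 + (h x)\<^sup>2)"
    by simp
qed

lemma integral_orthonormal_sum_square:
  assumes "finite F"
    and sq: "\<And>i. i \<in> F \<Longrightarrow> square_integrable \<mu> (\<phi> i)"
    and orth: "\<And>i j. i \<in> F \<Longrightarrow> j \<in> F \<Longrightarrow> (\<integral>x. \<phi> i x * \<phi> j x \<partial>\<mu>) = (if i = j then 1 else 0)"
  shows "integrable \<mu> (\<lambda>x. (\<Sum>i\<in>F. e i * \<phi> i x)\<^sup>2)"
    and "(\<integral>x. (\<Sum>i\<in>F. e i * \<phi> i x)\<^sup>2 \<partial>\<mu>) = (\<Sum>i\<in>F. (e i)\<^sup>2)"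
proof -
  have eq: "(\<Sum>i\<in>F. e i * \<phi> i x)\<^sup>2 = (\<Sum>i\<in>F. \<Sum>j\<in>F. (e i * e j) * (\<phi> i x * \<phi> j x))" for x
    by (simp add: power2_eq_square sum_product algebra_simps)
  have int: "integrable \<mu> (\<lambda>x. \<phi> i x * \<phi> j x)" if "i \<in> F" "j \<in> F" for i j
    using that by (intro integrable_mult_square_integrable sq)
  show "integrable \<mu> (\<lambda>x. (\<Sum>i\<in>F. e i * \<phi> i x)\<^sup>2)"
    unfolding eq by (intro Bochner_Integration.integrable_sum Bochner_Integration.integrable_mult_right int)
  have "(\<integral>x. (\<Sum>i\<in>F. e i * \<phi> i x)\<^sup>2 \<partial>\<mu>)
      = (\<Sum>i\<in>F. \<Sum>j\<in>F. (e i * e j) * (\<integral>x. \<phi> i x * \<phi> j x \<partial>\<mu>))"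
    unfolding eq by (simp add: int integral_sum)
  also have "\<dots> = (\<Sum>i\<in>F. \<Sum>j\<in>F. if i = j then (e i)\<^sup>2 else 0)"
    by (intro sum.cong refl) (simp add: orth power2_eq_square)
  also have "\<dots> = (\<Sum>i\<in>F. (e i)\<^sup>2)"
    using \<open>finite F\<close> by simp
  finally show "(\<integral>x. (\<Sum>i\<in>F. e i * \<phi> i x)\<^sup>2 \<partial>\<mu>) = (\<Sum>i\<in>F. (e i)\<^sup>2)" .
qed

text \<open>Fatou's lemma, applied to the squares of the partial sums.\<close>

lemma orthonormal_series_L2_le:
  fixes I :: "nat set"
  assumes sq: "\<And>i. i \<in> I \<Longrightarrow> square_integrable \<mu> (\<phi> i)"
    and orth: "\<And>i j. i \<in> I \<Longrightarrow> j \<in> I \<Longrightarrow> (\<integral>x. \<phi> i x * \<phi> j x \<partial>\<mu>) = (if i = j then 1 else 0)"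
    and e: "((\<lambda>i. (e i)\<^sup>2) has_sum C) I"
    and g: "\<And>x. x \<in> space \<mu> \<Longrightarrow> ((\<lambda>i. e i * \<phi> i x) has_sum g x) I"
  shows "square_integrable \<mu> g" and "(L2_norm \<mu> g)\<^sup>2 \<le> C"
proof -
  \<comment> \<open>The partial sums run over the members of \<open>I\<close> below
    \<open>n\<close>, so finite and infinite index sets are treated alike.\<close>
  define S where "S n x = (\<Sum>i\<in>{..<n} \<inter> I. e i * \<phi> i x)" for n x
  have phi_meas: "\<phi> i \<in> borel_measurable \<mu>" if "i \<in> I" for i
    using sq[OF that] by (simp add: square_integrable_def)
  have S_meas[measurable]: "S n \<in> borel_measurable \<mu>" for n
    unfolding S_def by (intro borel_measurable_sum borel_measurable_times phi_meas) auto
  have lim: "(\<lambda>n. S n x) \<longlonglongrightarrow> g x" if "x \<in> space \<mu>" for x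
  proof -
    \<comment> \<open>Extension by zero moves the unordered sum to all naturals, where it is also
      the limit over initial segments.\<close>
    have "((\<lambda>i. if i \<in> I then e i * \<phi> i x else 0) has_sum g x) UNIV"
      using g[OF that] by (subst has_sum_cong_neutral[where T = I]) auto
    from has_sum_imp_sums[OF this] show ?thesis
      by (simp add: sums_def S_def sum.inter_restrict)
  qed
  have g_meas[measurable]: "g \<in> borel_measurable \<mu>"
    by (rule borel_measurable_LIMSEQ_real[OF lim S_meas])
  have C: "(\<Sum>i\<in>{..<n} \<inter> I. (e i)\<^sup>2) \<le> C" for n
    by (rule finite_sum_le_has_sum[OF e]) auto
  have S_int: "(\<integral>\<^sup>+x. ennreal ((S n x)\<^sup>2) \<partial>\<mu>) \<le> ennreal C" for n
  proof -
    have "(\<integral>\<^sup>+x. ennreal ((S n x)\<^sup>2) \<partial>\<mu>) = ennreal (\<integral>x. (S n x)\<^sup>2 \<partial>\<mu>)"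
      unfolding S_def
      by (intro nn_integral_eq_integral integral_orthonormal_sum_square(1)) (auto simp: sq orth)
    also have "(\<integral>x. (S n x)\<^sup>2 \<partial>\<mu>) = (\<Sum>i\<in>{..<n} \<inter> I. (e i)\<^sup>2)"
      unfolding S_def by (intro integral_orthonormal_sum_square(2)) (auto simp: sq orth)
    finally show ?thesis
      using C by (simp add: ennreal_leI)
  qed
  have "(\<integral>\<^sup>+x. ennreal ((g x)\<^sup>2) \<partial>\<mu>) = (\<integral>\<^sup>+x. liminf (\<lambda>n. ennreal ((S n x)\<^sup>2)) \<partial>\<mu>)"
  proof (rule nn_integral_cong)
    fix x assume "x \<in> space \<mu>"
    then have "(\<lambda>n. ennreal ((S n x)\<^sup>2)) \<longlonglongrightarrow> ennreal ((g x)\<^sup>2)"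
      by (intro tendsto_ennrealI tendsto_power lim)
    then show "ennreal ((g x)\<^sup>2) = liminf (\<lambda>n. ennreal ((S n x)\<^sup>2))"
      by (metis lim_imp_Liminf sequentially_bot)
  qed
  also have "\<dots> \<le> liminf (\<lambda>n. \<integral>\<^sup>+x. ennreal ((S n x)\<^sup>2) \<partial>\<mu>)"
    by (rule nn_integral_liminf) measurable
  also have "\<dots> \<le> ennreal C"
    by (intro Liminf_le) (simp_all add: S_int)
  finally have bound: "(\<integral>\<^sup>+x. ennreal ((g x)\<^sup>2) \<partial>\<mu>) \<le> ennreal C" .
  have "integrable \<mu> (\<lambda>x. (g x)\<^sup>2)"
    by (rule integrableI_nonneg) (use bound in \<open>auto intro: le_less_trans\<close>)
  then show "square_integrable \<mu> g"
    by (simp add: square_integrable_def)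
  \<comment> \<open>Since \<open>ennreal\<close> truncates negative reals to 0, the sign of
    \<open>C\<close> is needed to return from \<open>ennreal C\<close> to a real bound.\<close>
  have "0 \<le> C"
    by (rule has_sum_nonneg[OF e]) simp
  then show "(L2_norm \<mu> g)\<^sup>2 \<le> C"
    unfolding L2_norm_def by (simp add: integral_real_bounded bound)
qed

section \<open>Mercer expansions\<close>

text \<open>For fixed \<open>q\<close> the map from B to q . B q is linear, hence commutes with the
  sum, and each term becomes lam j (p j . q)^2.\<close>

lemma psd_of_outer_product_has_sum:
  assumes "((\<lambda>j. lam j *\<^sub>R outer_product (p j)) has_sum E) J" "\<And>j. j \<in> J \<Longrightarrow> 0 \<le> lam j"
  shows "0 \<le> q \<bullet> (E *v q)"
proof -
  have "linear (\<lambda>B. q \<bullet> (B *v q))"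
    by (rule linearI) (simp_all add: matrix_vector_mult_add_rdistrib inner_add_right
        flip: scaleR_matrix_vector_assoc)
  then have "((\<lambda>j. q \<bullet> ((lam j *\<^sub>R outer_product (p j)) *v q)) has_sum q \<bullet> (E *v q)) J"
    using has_sum_bounded_linear[OF _ assms(1)] linear_conv_bounded_linear by blast
  then show ?thesis
    by (rule has_sum_nonneg)
      (simp add: assms(2) outer_product_mult inner_commute mult.assoc flip: scaleR_matrix_vector_assoc)
qed

text \<open>The trace is continuous and linear and sends p p^T to |p|^2. The resulting series later
  dominates the tail of the error bound.\<close>

lemma summable_outer_product_trace:
  fixes p :: "'i \<Rightarrow> real ^ 'n"
  assumes "((\<lambda>j. lam j *\<^sub>R outer_product (p j)) has_sum E) J"
  shows "(\<lambda>j. lam j * (norm (p j))\<^sup>2) summable_on J"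
proof -
  have "bounded_linear (\<lambda>B :: real ^ 'n ^ 'n. \<Sum>k\<in>UNIV. B $ k $ k)"
    by (intro bounded_linear_sum bounded_linear_compose[OF bounded_linear_vec_nth bounded_linear_vec_nth])
  from has_sum_imp_summable[OF has_sum_bounded_linear[OF this assms]] show ?thesis
    unfolding power2_norm_eq_inner
    by (simp add: outer_product_def inner_vec_def sum_distrib_left)
qed

text \<open>The matrix series with inner dimension \<open>'k\<close> sums to \<open>CARD('k)\<close>
  times \<open>E\<close>, so \<open>norm_psd_plus_scaled_le\<close> applies with c =
  \<open>CARD('k)\<close> >= 1, whatever \<open>'k\<close> is.\<close>

lemma norm_le_columnvector_rowvector_infsum:
  fixes p :: "nat \<Rightarrow> real ^ 'n"
  assumes E: "((\<lambda>j. lam j *\<^sub>R outer_product (p j)) has_sum E) J"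
    and "\<And>j. j \<in> J \<Longrightarrow> 0 \<le> lam j" "0 \<le> t"
  shows "norm (E *v q + t *\<^sub>R q) \<le>
    matrix_norm2 ((\<Sum>\<^sub>\<infinity>j\<in>J. lam j *\<^sub>R ((columnvector (p j) :: real ^ 'k ^ 'n) ** rowvector (p j)))
      + t *\<^sub>R mat 1) * norm q"
proof -
  have "((\<lambda>j. real CARD('k) *\<^sub>R (lam j *\<^sub>R outer_product (p j))) has_sum real CARD('k) *\<^sub>R E) J"
    by (rule has_sum_scaleR[OF E])
  then have sum: "(\<Sum>\<^sub>\<infinity>j\<in>J. lam j *\<^sub>R ((columnvector (p j) :: real ^ 'k ^ 'n) ** rowvector (p j)))
      = real CARD('k) *\<^sub>R E"
    by (intro infsumI) (simp add: columnvector_rowvector mult.commute)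
  have "1 \<le> real CARD('k)"
    using zero_less_card_finite[where 'a = 'k] by linarith
  then show ?thesis
    unfolding sum using assms
    by (intro norm_psd_plus_scaled_le psd_of_outer_product_has_sum[OF E])
qed

theorem theorem5p1:
  fixes X :: "(real ^ 'd) set"
    and \<mu> :: "(real ^ 'd) measure"
    and K :: "real ^ 'd \<Rightarrow> real ^ 'd \<Rightarrow> real"
    and lam :: "nat \<Rightarrow> real"
    and \<phi> \<psi> :: "nat \<Rightarrow> real ^ 'd \<Rightarrow> real"
    and l :: nat and l\<^sub>G\<^sub>P :: enat
    and xs :: "'n::finite \<Rightarrow> real ^ 'd"
    and w :: "'n \<Rightarrow> real"
    and f :: "real ^ 'd \<Rightarrow> real"
    and y :: "real ^ 'n"
    and m fhat :: "real ^ 'd \<Rightarrow> real"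
    and \<sigma> M w\<^sub>m\<^sub>a\<^sub>x s\<^sub>N :: real
    and R :: "real ^ 'n ^ 'n"
  assumes "1 \<le> l" and "enat l \<le> l\<^sub>G\<^sub>P"
    and "mercer_kernel X \<mu> K"
    and "mercer_expansion X \<mu> K l\<^sub>G\<^sub>P lam \<phi>"
    and "\<And>i x. i \<in> {1..l} \<Longrightarrow> x \<in> X \<Longrightarrow> \<psi> i x = \<phi> i x"
    and "\<And>k. xs k \<in> X"
    and "orthogonalizes \<mu> xs w l \<psi>"
    and "\<sigma>\<^sup>2 > 0"
    and "y = node_vec xs f"
    and "fhat = pseudospectral xs w l \<psi> f"
    and "m = gp_posterior_mean K \<sigma> xs y"
    and "R = gp_R K \<sigma> xs"
    and "M = Max {\<bar>\<psi> i (xs k)\<bar> | k i. i \<in> {1..l}}"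
    and "w\<^sub>m\<^sub>a\<^sub>x = Max {\<bar>w k\<bar> | k. True}"
    and "s\<^sub>N = Min (eigenvalues (kernel_matrix K xs))"
  shows "square_integrable \<mu> (\<lambda>x. m x - fhat x) \<and>
    (L2_norm \<mu> (\<lambda>x. m x - fhat x))\<^sup>2 \<le>
      (norm y)\<^sup>2 *
        (real l * real CARD('n) * M\<^sup>2 * w\<^sub>m\<^sub>a\<^sub>x\<^sup>2 / (s\<^sub>N + \<sigma>\<^sup>2)\<^sup>2 *
           (matrix_norm2
              ((\<Sum>\<^sub>\<infinity>j\<in>index_upto l\<^sub>G\<^sub>P - {1..l}.
                  lam j *\<^sub>R (columnvector (node_vec xs (\<phi> j)) ** rowvector (node_vec xs (\<phi> j))))
               + \<sigma>\<^sup>2 *\<^sub>R mat 1))\<^sup>2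
         + (\<Sum>\<^sub>\<infinity>j\<in>index_upto l\<^sub>G\<^sub>P - {1..l}.
              (lam j)\<^sup>2 * (node_vec xs (\<phi> j) \<bullet> ((R ** R) *v node_vec xs (\<phi> j)))))"
proof -
  let "_ \<and> _ \<le> _ * (_ * ?nrm\<^sup>2 + ?tail)" = ?thesis
  let ?I = "index_upto l\<^sub>G\<^sub>P" and ?J = "{1..l}"
  let ?T = "?I - ?J"
  let ?p = "\<lambda>j. node_vec xs (\<phi> j)"
  define A where "A = kernel_matrix K xs"
  \<comment> \<open>These are the weighted samples W phi_i: the pseudospectral coefficients are y .
    q i, and discrete orthonormality says that \<open>q\<close> is dual to the sample vectors
    \<open>?p\<close>.\<close>
  define q where "q i = (\<chi> k. w k * \<phi> i (xs k))" for i
  note xs = assms(6)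
  have "space \<mu> = space (restrict_space borel X)"
    using assms(3) by (intro sets_eq_imp_space_eq)
      (simp add: mercer_kernel_def strictly_positive_borel_def)
  then have space: "space \<mu> = X"
    by (simp add: space_restrict_space)
  have K_sym: "K x x' = K x' x" if "x \<in> X" "x' \<in> X" for x x'
    using assms(3) that by (simp add: mercer_kernel_def)
  have JI: "?J \<subseteq> ?I"
    using assms(2) by (auto simp: index_upto_def intro: order_trans[OF _ assms(2)])
  have lam: "0 \<le> lam i" and sq: "square_integrable \<mu> (\<phi> i)" if "i \<in> ?I" for i
    using assms(4) that by (simp_all add: mercer_expansion_def)
  have orth: "(\<integral>x. \<phi> i x * \<phi> j x \<partial>\<mu>) = (if i = j then 1 else 0)" if "i \<in> ?I" "j \<in> ?I" for i j
    using assms(4) that by (simp add: mercer_expansion_def)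
  have K: "((\<lambda>i. lam i * \<phi> i x * \<phi> i x') has_sum K x x') ?I" if "x \<in> X" "x' \<in> X" for x x'
    using assms(4) that
    by (simp add: mercer_expansion_def has_sum_iff abs_summable_summable[where 'b = real, simplified])

  \<comment> \<open>Kernel matrix, its tail and the regularized inverse\<close>
  have A_sum: "((\<lambda>j. lam j *\<^sub>R outer_product (?p j)) has_sum A) ?I"
    using K[OF xs xs] unfolding A_def
    by (intro has_sum_vecI) (simp add: kernel_matrix_def outer_product_def node_vec_def mult.assoc)
  \<comment> \<open>Defining \<open>E\<close> by a finite subtraction gives the splitting of
    \<open>A\<close> required by \<open>regularized_coefficient_bound\<close> at once; that
    \<open>E\<close> is the sum of the tail then follows.\<close>
  define E where "E = A - (\<Sum>j\<in>?J. lam j *\<^sub>R outer_product (?p j))"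
  have E_sum: "((\<lambda>j. lam j *\<^sub>R outer_product (?p j)) has_sum E) ?T"
    unfolding E_def by (rule has_sum_Diff[OF A_sum has_sum_finite JI]) simp
  have A_symmetric: "transpose A = A"
    unfolding A_def by (simp add: kernel_matrix_def transpose_def vec_eq_iff K_sym xs)
  have s_eig: "s\<^sub>N \<in> eigenvalues A" and s_low: "s\<^sub>N * (norm v)\<^sup>2 \<le> v \<bullet> (A *v v)" for v
    using Min_eigenvalues_symmetric[OF A_symmetric] assms(15) by (simp_all add: A_def)
  \<comment> \<open>The expansion at the nodes, with nonnegative \<open>lam\<close>, makes
    \<open>A\<close> positive semidefinite; an eigenvector for \<open>s\<^sub>N\<close> then forces
    \<open>s\<^sub>N\<close> >= 0.\<close>
  obtain v where "v \<noteq> 0" "A *v v = s\<^sub>N *\<^sub>R v"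
    using s_eig by (auto simp: eigenvalues_def)
  moreover have "0 \<le> v \<bullet> (A *v v)"
    by (rule psd_of_outer_product_has_sum[OF A_sum lam])
  ultimately have "0 \<le> s\<^sub>N"
    by (metis inner_gt_zero_iff inner_scaleR_right not_le mult_less_0_iff)
  then have s_pos: "0 < s\<^sub>N + \<sigma>\<^sup>2"
    using assms(8) by linarith
  have R: "R = matrix_inv (A + \<sigma>\<^sup>2 *\<^sub>R mat 1)"
    unfolding assms(12) gp_R_def A_def kernel_matrix_def
    by (rule arg_cong[where f = matrix_inv]) (simp add: vec_eq_iff mat_def)
  have coercive: "(s\<^sub>N + \<sigma>\<^sup>2) * (norm v)\<^sup>2 \<le> v \<bullet> ((A + \<sigma>\<^sup>2 *\<^sub>R mat 1) *v v)" for v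
    using s_low[of v]
    by (simp add: matrix_scaleR_mat_1_mult inner_add_right power2_norm_eq_inner distrib_right)
  have R_norm: "norm (R *v u) \<le> norm u / (s\<^sub>N + \<sigma>\<^sup>2)" for u
    unfolding R by (rule matrix_inv_coercive(2)[OF s_pos coercive])
  have "transpose (A + \<sigma>\<^sup>2 *\<^sub>R mat 1) = A + \<sigma>\<^sup>2 *\<^sub>R mat 1"
    using A_symmetric by (auto simp: transpose_def vec_eq_iff mat_def)
  then have R_symmetric: "transpose R = R"
    unfolding R by (intro transpose_matrix_inv_symmetric matrix_inv_coercive(1)[OF s_pos coercive])

  \<comment> \<open>Expansion of \<open>m - fhat\<close> in the eigenfunctions\<close>
  define e where "e j = lam j * (y \<bullet> (R *v ?p j)) - (if j \<in> ?J then y \<bullet> q j else 0)" for j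
  have series: "((\<lambda>i. e i * \<phi> i x) has_sum m x - fhat x) ?I" if "x \<in> X" for x
  proof -
    have kvec: "((\<lambda>i. (lam i * \<phi> i x) *\<^sub>R ?p i) has_sum node_vec xs (\<lambda>x'. K x' x)) ?I"
      using K[OF xs that]
      by (intro has_sum_vecI) (simp add: node_vec_def ac_simps)
    \<comment> \<open>This functional is continuous and linear, so it may be applied termwise to the
      series of the kernel vector at \<open>x\<close>.\<close>
    have "bounded_linear (\<lambda>u. y \<bullet> (R *v u))"
      by (intro bounded_linear_inner_right_comp matrix_vector_mul_bounded_linear)
    from has_sum_bounded_linear[OF this kvec]
    have "((\<lambda>i. y \<bullet> (R *v ((lam i * \<phi> i x) *\<^sub>R ?p i))) has_sum m x) ?I"
      unfolding assms(11) gp_posterior_mean_def assms(12)[symmetric] .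
    then have m: "((\<lambda>i. lam i * (y \<bullet> (R *v ?p i)) * \<phi> i x) has_sum m x) ?I"
      by (simp add: matrix_vector_mult_scaleR mult.assoc mult.commute mult.left_commute)
    have "fhat x = (\<Sum>i\<in>?J. (y \<bullet> q i) * \<phi> i x)"
      unfolding assms(10) pseudospectral_def
      by (rule sum.cong)
        (simp_all add: assms(5) xs that assms(9) node_vec_def q_def inner_vec_def mult.assoc
          mult.left_commute)
    \<comment> \<open>Zero coefficients beyond \<open>l\<close> put \<open>fhat\<close> on the same
      index set as \<open>m\<close>, so that the two series subtract termwise.\<close>
    then have "((\<lambda>i. (if i \<in> ?J then y \<bullet> q i else 0) * \<phi> i x) has_sum fhat x) ?I"
      using JI by (intro has_sum_finite_neutralI[where B = ?J]) auto
    from has_sum_add[OF m has_sum_uminusI[OF this]] show ?thesis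
      by (simp add: e_def left_diff_distrib)
  qed

  \<comment> \<open>Coefficients beyond \<open>l\<close>: summability and bound\<close>
  have lam_bound: "lam j \<le> (\<integral>x. \<bar>K x x\<bar> \<partial>\<mu>)" if "j \<in> ?I" for j
  proof -
    have int: "integrable \<mu> (\<lambda>x. lam j * (\<phi> j x * \<phi> j x))"
      by (intro Bochner_Integration.integrable_mult_right integrable_mult_square_integrable sq that)
    have "lam j = (\<integral>x. lam j * (\<phi> j x * \<phi> j x) \<partial>\<mu>)"
      using orth[OF that that] by simp
    also have "\<dots> \<le> (\<integral>x. \<bar>K x x\<bar> \<partial>\<mu>)"
    proof (rule integral_mono[OF int])
      show "integrable \<mu> (\<lambda>x. \<bar>K x x\<bar>)"
        using assms(3) by (simp add: mercer_kernel_def)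
      fix x assume "x \<in> space \<mu>"
      \<comment> \<open>On the diagonal all terms of the expansion are nonnegative, so a single one
        is at most \<open>K x x\<close>; the normalization of the eigenfunction then isolates
        \<open>lam j\<close>.\<close>
      then have "(\<Sum>i\<in>{j}. lam i * \<phi> i x * \<phi> i x) \<le> K x x"
        using that lam by (intro finite_sum_le_has_sum[OF K]) (auto simp: space mult.assoc)
      then show "lam j * (\<phi> j x * \<phi> j x) \<le> \<bar>K x x\<bar>"
        by (simp add: mult.assoc)
    qed
    finally show ?thesis .
  qed

  define a where "a j = (lam j)\<^sup>2 * (?p j \<bullet> ((R ** R) *v ?p j))" for j
  have a: "a j = (lam j)\<^sup>2 * (norm (R *v ?p j))\<^sup>2" for j
    unfolding a_def power2_norm_eq_inner
    by (simp add: inner_symmetric_matrix[OF R_symmetric] flip: matrix_vector_mul_assoc)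
  \<comment> \<open>A divergent unordered sum has the default value 0, so the tail of the bound can
    dominate anything only once \<open>a\<close> is known to be summable.\<close>
  have a_summable: "a summable_on ?T"
  proof (rule summable_on_comparison_test)
    \<comment> \<open>One factor \<open>lam j\<close> is replaced by the integral of the diagonal,
      the other stays in the trace series of \<open>E\<close>; the denominator comes from the norm
      of \<open>R\<close>.\<close>
    let ?c = "(\<integral>x. \<bar>K x x\<bar> \<partial>\<mu>) / (s\<^sub>N + \<sigma>\<^sup>2)\<^sup>2"
    show "(\<lambda>j. ?c * (lam j * (norm (?p j))\<^sup>2)) summable_on ?T"
      by (intro summable_on_cmult_right summable_outer_product_trace[OF E_sum])
    fix j assume j: "j \<in> ?T"
    have "a j \<le> (lam j)\<^sup>2 * (norm (?p j) / (s\<^sub>N + \<sigma>\<^sup>2))\<^sup>2"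
      unfolding a by (intro mult_left_mono power_mono R_norm) auto
    also have "\<dots> = lam j * (lam j * (norm (?p j) / (s\<^sub>N + \<sigma>\<^sup>2))\<^sup>2)"
      by (simp add: power2_eq_square)
    also have "\<dots> \<le> (\<integral>x. \<bar>K x x\<bar> \<partial>\<mu>) * (lam j * (norm (?p j) / (s\<^sub>N + \<sigma>\<^sup>2))\<^sup>2)"
      using j by (intro mult_right_mono lam_bound mult_nonneg_nonneg lam) auto
    finally show "a j \<le> ?c * (lam j * (norm (?p j))\<^sup>2)"
      by (simp add: power_divide)
  qed (simp add: a)

  have tail: "(e j)\<^sup>2 \<le> (norm y)\<^sup>2 * a j" if "j \<in> ?T" for j
  proof -
    have "(y \<bullet> (R *v ?p j))\<^sup>2 \<le> (norm y)\<^sup>2 * (norm (R *v ?p j))\<^sup>2"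
      using Cauchy_Schwarz_ineq[of y "R *v ?p j"] by (simp add: power2_norm_eq_inner)
    then have "(lam j)\<^sup>2 * (y \<bullet> (R *v ?p j))\<^sup>2 \<le> (lam j)\<^sup>2 * ((norm y)\<^sup>2 * (norm (R *v ?p j))\<^sup>2)"
      by (rule mult_left_mono) simp
    moreover have "e j = lam j * (y \<bullet> (R *v ?p j))"
      using that by (auto simp: e_def)
    ultimately show ?thesis
      by (simp add: a power_mult_distrib mult.left_commute)
  qed
  have e_summable: "(\<lambda>j. (e j)\<^sup>2) summable_on ?T"
    by (rule summable_on_comparison_test[OF summable_on_cmult_right[OF a_summable] tail]) auto
  have tail_sum: "(\<Sum>\<^sub>\<infinity>j\<in>?T. (e j)\<^sup>2) \<le> (norm y)\<^sup>2 * ?tail"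
  proof -
    have "(\<Sum>\<^sub>\<infinity>j\<in>?T. (e j)\<^sup>2) \<le> (\<Sum>\<^sub>\<infinity>j\<in>?T. (norm y)\<^sup>2 * a j)"
      by (intro infsum_mono e_summable summable_on_cmult_right a_summable tail)
    also have "\<dots> = (norm y)\<^sup>2 * (\<Sum>\<^sub>\<infinity>j\<in>?T. a j)"
      by (intro infsum_cmult_right a_summable)
    finally show ?thesis
      by (simp add: a_def)
  qed

  \<comment> \<open>Coefficients up to \<open>l\<close>\<close>
  have quadrature: "?p j \<bullet> q i = (if j = i then 1 else 0)" if "i \<in> ?J" "j \<in> ?J" for i j
  proof -
    \<comment> \<open>The nodes lie in \<open>X\<close>, where \<open>\<psi>\<close> and
      \<open>\<phi>\<close> agree, so the quadrature condition transfers to the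
      eigenfunctions.\<close>
    have "?p j \<bullet> q i = (\<Sum>k\<in>UNIV. w k * \<psi> j (xs k) * \<psi> i (xs k))"
      using that by (simp add: inner_vec_def node_vec_def q_def assms(5) xs mult.left_commute mult.assoc)
    then show ?thesis
      using assms(7) that by (simp add: orthogonalizes_def)
  qed
  have q_norm: "(norm (q i))\<^sup>2 \<le> real CARD('n) * M\<^sup>2 * w\<^sub>m\<^sub>a\<^sub>x\<^sup>2" if "i \<in> ?J" for i
  proof -
    have "finite {\<bar>\<psi> i (xs k)\<bar> | k i. i \<in> ?J}"
      by (rule finite_subset[of _ "(\<lambda>(k, i). \<bar>\<psi> i (xs k)\<bar>) ` (UNIV \<times> ?J)"]) auto
    then have M: "\<bar>\<phi> i (xs k)\<bar> \<le> M" for k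
      unfolding assms(13) using that assms(5)[OF that xs[of k], symmetric] by (intro Max_ge) auto
    have W: "\<bar>w k\<bar> \<le> w\<^sub>m\<^sub>a\<^sub>x" for k
      unfolding assms(14) by (intro Max_ge) (auto simp: full_SetCompr_eq)
    have "(norm (q i))\<^sup>2 = (\<Sum>k\<in>UNIV. \<bar>w k\<bar>\<^sup>2 * \<bar>\<phi> i (xs k)\<bar>\<^sup>2)"
      unfolding power2_norm_eq_inner
      by (simp add: inner_vec_def q_def power2_eq_square mult.assoc mult.left_commute)
    also have "\<dots> \<le> (\<Sum>k\<in>(UNIV :: 'n set). w\<^sub>m\<^sub>a\<^sub>x\<^sup>2 * M\<^sup>2)"
      by (intro sum_mono mult_mono power_mono M W) auto
    finally show ?thesis
      by (simp add: ac_simps)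
  qed
  let ?head = "real CARD('n) * M\<^sup>2 * w\<^sub>m\<^sub>a\<^sub>x\<^sup>2 / (s\<^sub>N + \<sigma>\<^sup>2)\<^sup>2 * ?nrm\<^sup>2"
  have head: "(e i)\<^sup>2 \<le> (norm y)\<^sup>2 * ?head" if i: "i \<in> ?J" for i
  proof -
    have nrm: "norm (E *v q i + \<sigma>\<^sup>2 *\<^sub>R q i) \<le> ?nrm * norm (q i)"
      by (rule norm_le_columnvector_rowvector_infsum[OF E_sum]) (use lam in auto)
    have "e i = y \<bullet> (lam i *\<^sub>R (R *v ?p i) - q i)"
      using i by (simp add: e_def inner_diff_right)
    then have "(e i)\<^sup>2 \<le> (norm y)\<^sup>2 * (norm (lam i *\<^sub>R (R *v ?p i) - q i))\<^sup>2"
      using Cauchy_Schwarz_ineq[of y "lam i *\<^sub>R (R *v ?p i) - q i"]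
      by (simp add: power2_norm_eq_inner)
    also have "\<dots> \<le> (norm y)\<^sup>2 * (norm (E *v q i + \<sigma>\<^sup>2 *\<^sub>R q i) / (s\<^sub>N + \<sigma>\<^sup>2))\<^sup>2"
      unfolding R
      by (intro mult_left_mono power_mono regularized_coefficient_bound[OF s_low s_pos _ _ i])
        (simp_all add: E_def quadrature[OF i])
    also have "\<dots> \<le> (norm y)\<^sup>2 * (?nrm * norm (q i) / (s\<^sub>N + \<sigma>\<^sup>2))\<^sup>2"
      using s_pos by (intro mult_left_mono power_mono divide_right_mono nrm) auto
    also have "\<dots> = (norm y)\<^sup>2 * ((norm (q i))\<^sup>2 / (s\<^sub>N + \<sigma>\<^sup>2)\<^sup>2 * ?nrm\<^sup>2)"
      by (simp add: power_mult_distrib power_divide mult.commute)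
    also have "\<dots> \<le> (norm y)\<^sup>2 * ?head"
      by (intro mult_left_mono mult_right_mono divide_right_mono q_norm i) auto
    finally show ?thesis .
  qed
  \<comment> \<open>The bound \<open>head\<close> does not depend on \<open>i\<close>; summing it
    over the \<open>l\<close> indices produces the factor \<open>l\<close>.\<close>
  have "(\<Sum>i\<in>?J. (e i)\<^sup>2) \<le> real (card ?J) * ((norm y)\<^sup>2 * ?head)"
    by (rule sum_bounded_above) (rule head)
  then have head_sum: "(\<Sum>i\<in>?J. (e i)\<^sup>2) \<le> (norm y)\<^sup>2 * (real l * ?head)"
    by (simp add: mult.left_commute)

  \<comment> \<open>Norm of the whole series from its two blocks of coefficients\<close>
  have "((\<lambda>i. (e i)\<^sup>2) has_sum (\<Sum>i\<in>?J. (e i)\<^sup>2) + (\<Sum>\<^sub>\<infinity>j\<in>?T. (e j)\<^sup>2)) (?J \<union> ?T)"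
    by (intro has_sum_Un_disjoint has_sum_finite has_sum_infsum e_summable) auto
  then have e_sum: "((\<lambda>i. (e i)\<^sup>2) has_sum (\<Sum>i\<in>?J. (e i)\<^sup>2) + (\<Sum>\<^sub>\<infinity>j\<in>?T. (e j)\<^sup>2)) ?I"
    using JI by (simp add: Un_absorb1)
  note L2 = orthonormal_series_L2_le[OF sq orth e_sum series, unfolded space]
  have "(L2_norm \<mu> (\<lambda>x. m x - fhat x))\<^sup>2
      \<le> (norm y)\<^sup>2 * (real l * ?head) + (norm y)\<^sup>2 * ?tail"
    using L2(2) head_sum tail_sum by linarith
  then show ?thesis
    using L2(1) by (simp add: distrib_left mult.assoc)
qed

end
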